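(* (i) Let $n\ge 5$ be odd and $\frac{n+1}{2}\le p\le n-2$, and put $r=\sum_{i=0}^{p-\frac{n-1}{2}}\binom{n}{i}$. Then $b(Q_n^p)\le 2^{n-1}+\lceil r/2\rceil-1$. (ii) Let $n\ge 6$ be even and $\frac{n}{2}+1\le p\le n-2$, and put $r'=\sum_{i=0}^{p-\frac{n}{2}}\binom{n}{i}+\binom{n-1}{p-\frac{n}{2}}$. Then $b(Q_n^p)\le 2^{n-1}+\lceil r'/2\rceil-1$.
   Context: The hypercube $Q_n$ has vertex set the power set $2^{[n]}$ of $[n]=\{1,\dots,n\}$, with $x,y$ adjacent iff $|x\triangle y|=1$. The $p$-th power $Q_n^p$ has the same vertex set, with distinct $x,y$ adjacent iff $|x\triangle y|\le p$. A b-coloring of a graph $G$ with $k$ colors is a proper vertex coloring with $k$ colors in which every color class contains a vertex adjacent to at least one vertex of every other color class; the b-chromatic number $b(G)$ is the largest $k$ for which $G$ has a b-coloring with $k$ colors. *)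

theory Defs
  imports Complex_Main "Graph_Theory.Pair_Digraph"
begin

(* Finite simple graphs are the symmetric loop-free pair digraphs (locale pair_graph) of
   Graph_Theory: each undirected edge is a pair of opposite arcs, and u, v are adjacent iff
   (u, v) is an arc.  Q_n itself is hypercube_power n 1. *)

definition hypercube_power :: "nat \<Rightarrow> nat \<Rightarrow> nat set pair_pre_digraph" where
  "hypercube_power n p = \<lparr> pverts = Pow {1..n},
     parcs = {(x, y). x \<in> Pow {1..n} \<and> y \<in> Pow {1..n} \<and> x \<noteq> y \<and> card (sym_diff x y) \<le> p} \<rparr>"

definition proper_coloring :: "'a pair_pre_digraph \<Rightarrow> nat \<Rightarrow> ('a \<Rightarrow> nat) \<Rightarrow> bool" where
  "proper_coloring G k c \<longleftrightarrow>
     (\<forall>v \<in> pverts G. c v < k) \<and> (\<forall>(u, v) \<in> parcs G. c u \<noteq> c v)"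

(* The condition on the classes also forces all k color classes to be nonempty. *)
definition b_coloring :: "'a pair_pre_digraph \<Rightarrow> nat \<Rightarrow> ('a \<Rightarrow> nat) \<Rightarrow> bool" where
  "b_coloring G k c \<longleftrightarrow> proper_coloring G k c \<and>
     (\<forall>i < k. \<exists>v \<in> pverts G. c v = i \<and>
        (\<forall>j < k. j \<noteq> i \<longrightarrow> (\<exists>w \<in> pverts G. c w = j \<and> (v, w) \<in> parcs G)))"

(* Meaningful for finite simple graphs, see b_chromatic_number_greatest below. *)
definition b_chromatic_number :: "'a pair_pre_digraph \<Rightarrow> nat" where
  "b_chromatic_number G = Max {k. \<exists>c. b_coloring G k c}"

lemma pair_graph_hypercube_power: "pair_graph (hypercube_power n p)"
proof
  show "symmetric (with_proj (hypercube_power n p))"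
    unfolding symmetric_def sym_def
    by (auto simp: hypercube_power_def arcs_ends_conv Un_commute intro!: symI)
  have "parcs (hypercube_power n p) \<subseteq> Pow {1..n} \<times> Pow {1..n}"
    by (auto simp: hypercube_power_def)
  then show "finite (parcs (hypercube_power n p))"
    by (rule finite_subset) simp
qed (auto simp: hypercube_power_def)

lemma b_coloring_le_card:
  assumes "finite (pverts G)" "b_coloring G k c"
  shows "k \<le> card (pverts G)"
proof -
  have "{..<k} \<subseteq> c ` pverts G"
    using assms(2) unfolding b_coloring_def by blast
  then have "card {..<k} \<le> card (c ` pverts G)"
    using assms(1) by (intro card_mono) auto
  also have "\<dots> \<le> card (pverts G)"
    using assms(1) by (rule card_image_le)
  finally show ?thesis by simp
qed

lemma b_coloring_exists:
  assumes "pair_graph G"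
  shows "\<exists>k c. b_coloring G k c"
proof -
  interpret pair_graph G by fact
  obtain f :: "'a \<Rightarrow> nat" where f: "inj_on f (pverts G)" "f ` pverts G = {i. i < card (pverts G)}"
    using finite_imp_inj_to_nat_seg[OF finite_verts]
    by (metis card_image card_Collect_less_nat pair_finite_verts finite_imp_inj_to_nat_seg)
  have "proper_coloring G (card (pverts G)) f"
    unfolding proper_coloring_def
    using f in_arcsD1 in_arcsD2 no_loops' by (fastforce dest: inj_onD)
  then have ex: "\<exists>k c. proper_coloring G k c" by blast
  define k where "k = (LEAST k. \<exists>c. proper_coloring G k c)"
  obtain c where c: "proper_coloring G k c"
    using LeastI_ex[OF ex] unfolding k_def by blast
  have least: "\<not> proper_coloring G m d" if "m < k" for m d
    using not_less_Least that unfolding k_def by blast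
  have "b_coloring G k c"
  proof (rule ccontr)
    assume "\<not> b_coloring G k c"
    then obtain i where i: "i < k" and no_b: "\<And>v. v \<in> pverts G \<Longrightarrow> c v = i \<Longrightarrow>
        \<exists>j<k. j \<noteq> i \<and> (\<forall>w \<in> pverts G. c w = j \<longrightarrow> (v, w) \<notin> parcs G)"
      using c unfolding b_coloring_def by blast
    then obtain g where g: "\<And>v. v \<in> pverts G \<Longrightarrow> c v = i \<Longrightarrow>
        g v < k \<and> g v \<noteq> i \<and> (\<forall>w \<in> pverts G. c w = g v \<longrightarrow> (v, w) \<notin> parcs G)"
      by metis
    define d where "d v = (if c v = i then g v else c v)" for v
    define e where "e v = (if d v = k - 1 then i else d v)" for v
    have d_bound: "d v < k \<and> d v \<noteq> i" if "v \<in> pverts G" for v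
      using that g c unfolding d_def proper_coloring_def by auto
    have d_proper: "d u \<noteq> d v" if "(u, v) \<in> parcs G" for u v
    proof -
      have "u \<in> pverts G" "v \<in> pverts G" "(v, u) \<in> parcs G" "c u \<noteq> c v"
        using that c in_arcsD1 in_arcsD2 arcs_symmetric unfolding proper_coloring_def by auto
      then show ?thesis using that g unfolding d_def by metis
    qed
    have "e v < k - 1" if "v \<in> pverts G" for v
      using d_bound[OF that] i unfolding e_def by auto
    moreover have "e u \<noteq> e v" if "(u, v) \<in> parcs G" for u v
      using d_proper[OF that] d_bound[of u] d_bound[of v] that in_arcsD1 in_arcsD2
      unfolding e_def by auto
    ultimately have "proper_coloring G (k - 1) e"
      unfolding proper_coloring_def by auto
    then show False using least i by simp
  qed
  then show ?thesis by blast
qed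

lemma b_chromatic_number_greatest:
  assumes "pair_graph G"
  shows "\<exists>c. b_coloring G (b_chromatic_number G) c"
    and "b_coloring G k c \<Longrightarrow> k \<le> b_chromatic_number G"
proof -
  interpret pair_graph G by fact
  let ?K = "{k. \<exists>c. b_coloring G k c}"
  have fin: "finite ?K"
    using b_coloring_le_card[OF pair_finite_verts] by (auto intro: finite_subset[of _ "{..card (pverts G)}"])
  have "b_chromatic_number G \<in> ?K"
    unfolding b_chromatic_number_def using fin b_coloring_exists[OF assms] by (intro Max_in) auto
  then show "\<exists>c. b_coloring G (b_chromatic_number G) c" by simp
  show "k \<le> b_chromatic_number G" if "b_coloring G k c"
    unfolding b_chromatic_number_def using fin that by (intro Max_ge) auto
qed

end

theory Submission
  imports Defs "HOL-Library.Nat_Bijection"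
begin

text \<open>If a b-coloring has \<open>2 ^ (n - 1) + \<lceil>r / 2\<rceil>\<close> or more colors, counting vertices yields at least
  \<open>r\<close> singleton color classes. Each of these is at distance at most \<open>p\<close> from the chosen dominating
  vertex of every class, so the complements of the dominating vertices lie outside the
  \<open>(n - p - 1)\<close>-neighbourhood of a family of \<open>r\<close> sets. The number \<open>r\<close> is the size of a Hamming ball
  (for \<open>n\<close> even: of a ball in \<open>Q\<^bsub>n-1\<^esub>\<close> times an edge) whose \<open>(n - p - 1)\<close>-neighbourhood is half of
  the cube, so by Harper's vertex-isoperimetric theorem at most \<open>2 ^ (n - 1)\<close> complements remain
  for the dominating vertices.

  Harper's theorem is proved by induction on the dimension. Among the families of a given size
  with small neighbourhood take one that minimises the sum of the ranks in the simplicial order;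
  replacing its sections by initial segments would decrease that sum, so all sections are initial
  segments. Such a family is an initial segment itself, up to exchanging its last element with
  its complement.\<close>

section \<open>Neighbourhoods and their sections\<close>

text \<open>The closed neighbourhood in the cube on \<open>A\<close>, that is, all vertices within
  distance 1. For each \<open>a\<close>, one of \<open>insert a x\<close> and \<open>x - {a}\<close>
  flips the coordinate and the other is \<open>x\<close> itself.\<close>

definition neighbourhood :: "'a set \<Rightarrow> 'a set set \<Rightarrow> 'a set set" where
  "neighbourhood A S = {x \<in> Pow A. x \<in> S \<or> (\<exists>a\<in>A. insert a x \<in> S \<or> x - {a} \<in> S)}"

lemma neighbourhood_subset: "neighbourhood A S \<subseteq> Pow A"
  by (auto simp: neighbourhood_def)

lemma finite_neighbourhood: "finite A \<Longrightarrow> finite (neighbourhood A S)"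
  using finite_subset[OF neighbourhood_subset] by simp

lemma neighbourhood_mono: "S \<subseteq> T \<Longrightarrow> neighbourhood A S \<subseteq> neighbourhood A T"
  by (auto simp: neighbourhood_def)

lemma insert_mem_image_insert_iff:
  assumes "i \<notin> B" "Q \<subseteq> Pow B" "z \<subseteq> B"
  shows "insert i z \<in> insert i ` Q \<longleftrightarrow> z \<in> Q"
proof
  assume "insert i z \<in> insert i ` Q"
  then obtain q where q: "q \<in> Q" "insert i z = insert i q" by blast
  have "i \<notin> q" "i \<notin> z" using assms q(1) by auto
  then have "z = q" using q(2) insert_ident by metis
  then show "z \<in> Q" using q(1) by simp
qed auto

text \<open>\<open>P\<close> and \<open>Q\<close> are the sections of a family at \<open>i\<close>:
  the members avoiding \<open>i\<close>, and those containing \<open>i\<close> with \<open>i\<close>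
  removed. Flipping a coordinate of \<open>B\<close> stays within a section; flipping
  \<open>i\<close> moves a set unchanged into the other one.\<close>

lemma neighbourhood_sections:
  assumes i: "i \<notin> B" and P: "P \<subseteq> Pow B" and Q: "Q \<subseteq> Pow B"
  shows "neighbourhood (insert i B) (P \<union> insert i ` Q) =
    (neighbourhood B P \<union> Q) \<union> insert i ` (neighbourhood B Q \<union> P)" (is "?L = ?R")
proof -
  let ?S = "P \<union> insert i ` Q"
  have mem: "insert i z \<in> P \<union> insert i ` Q \<longleftrightarrow> z \<in> Q" if "z \<subseteq> B" for z
    using insert_mem_image_insert_iff[OF i Q that] i P by auto
  have mem': "z \<in> P \<union> insert i ` Q \<longleftrightarrow> z \<in> P" if "z \<subseteq> B" for z
    using i that by auto
  have sub: "neighbourhood B Q \<union> P \<subseteq> Pow B"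
    using P neighbourhood_subset[of B Q] by simp
  have nb: "v \<in> ?L \<longleftrightarrow> v \<in> ?S \<or> insert i v \<in> ?S \<or> v - {i} \<in> ?S \<or>
      (\<exists>a\<in>B. insert a v \<in> ?S \<or> v - {a} \<in> ?S)" if "v \<subseteq> insert i B" for v
    using that by (simp add: neighbourhood_def)
  have 1: "x \<in> ?L \<longleftrightarrow> x \<in> ?R" if x: "x \<subseteq> B" for x
  proof -
    have ins: "insert a x \<subseteq> B" "x - {a} \<subseteq> B" if "a \<in> B" for a
      using that x by auto
    have "x \<in> ?L \<longleftrightarrow> x \<in> P \<or> x \<in> Q \<or> (\<exists>a\<in>B. insert a x \<in> P \<or> x - {a} \<in> P)"
    proof -
      have "x \<subseteq> insert i B" "x - {i} = x" using x i by auto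
      moreover have "(\<exists>a\<in>B. insert a x \<in> ?S \<or> x - {a} \<in> ?S) \<longleftrightarrow>
          (\<exists>a\<in>B. insert a x \<in> P \<or> x - {a} \<in> P)"
        using mem'[OF ins(1)] mem'[OF ins(2)] by (intro bex_cong) simp_all
      ultimately show ?thesis using nb[of x] mem[OF x] mem'[OF x] by argo
    qed
    also have "\<dots> \<longleftrightarrow> x \<in> ?R"
      using i x by (auto simp: neighbourhood_def)
    finally show ?thesis .
  qed
  have 2: "insert i x \<in> ?L \<longleftrightarrow> insert i x \<in> ?R" if x: "x \<subseteq> B" for x
  proof -
    have ins: "insert a x \<subseteq> B" "x - {a} \<subseteq> B" "insert a (insert i x) = insert i (insert a x)"
        "insert i x - {a} = insert i (x - {a})" if "a \<in> B" for a
      using that x i by auto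
    have "insert i x \<in> ?L \<longleftrightarrow> x \<in> P \<or> x \<in> Q \<or> (\<exists>a\<in>B. insert a x \<in> Q \<or> x - {a} \<in> Q)"
    proof -
      have "insert i x \<subseteq> insert i B" "insert i x - {i} = x" using x i by auto
      moreover have "(\<exists>a\<in>B. insert a (insert i x) \<in> ?S \<or> insert i x - {a} \<in> ?S) \<longleftrightarrow>
          (\<exists>a\<in>B. insert a x \<in> Q \<or> x - {a} \<in> Q)"
        using mem[OF ins(1)] mem[OF ins(2)] by (intro bex_cong) (simp_all only: ins(3,4))
      moreover have "insert i (insert i x) = insert i x" by simp
      ultimately show ?thesis using nb[of "insert i x"] mem[OF x] mem'[OF x] by metis
    qed
    also have "\<dots> \<longleftrightarrow> x \<in> neighbourhood B Q \<union> P"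
      using x by (auto simp: neighbourhood_def)
    also have "\<dots> \<longleftrightarrow> insert i x \<in> ?R"
      using insert_mem_image_insert_iff[OF i sub x] i Q neighbourhood_subset[of B P] by auto
    finally show ?thesis .
  qed
  show ?thesis
  proof (rule set_eqI)
    fix x
    consider "x \<subseteq> B" | y where "y \<subseteq> B" "x = insert i y" | "\<not> x \<subseteq> insert i B"
    proof (cases "i \<in> x")
      case True
      then have "x = insert i (x - {i})" by blast
      then show thesis using that(2)[of "x - {i}"] that(3) by blast
    qed (use that in blast)
    then show "x \<in> ?L \<longleftrightarrow> x \<in> ?R"
    proof cases
      case 3
      then have "x \<notin> ?L" "x \<notin> ?R"
        using Q sub neighbourhood_subset[of "insert i B" "P \<union> insert i ` Q"]
          neighbourhood_subset[of B P] by auto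
      then show ?thesis by blast
    qed (use 1 2 in simp_all)
  qed
qed

lemma card_sections:
  assumes "finite B" "i \<notin> B" "P \<subseteq> Pow B" "Q \<subseteq> Pow B"
  shows "card (P \<union> insert i ` Q) = card P + card Q"
proof -
  have "inj_on (insert i) Q"
    using assms by (intro inj_onI) (subst (asm) insert_ident, auto)
  moreover have "P \<inter> insert i ` Q = {}" using assms by auto
  ultimately show ?thesis
    using assms by (simp add: card_Un_disjoint card_image finite_subset[of _ "Pow B"])
qed

section \<open>The simplicial order\<close>

text \<open>For subsets of \<open>{..<N}\<close> the rank is \<open>card x * 2 ^ N - set_encode x\<close>: it orders by size, and
  within one size the sets with the larger top elements come first. Being a sum of weights, it is
  compatible with sections.\<close>

definition simplicial_rank :: "nat \<Rightarrow> nat set \<Rightarrow> nat" where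
  "simplicial_rank N x = (\<Sum>i\<in>x. 2 ^ N - 2 ^ i)"

text \<open>Comparison of binary numbers at digit \<open>j\<close>: the powers below
  \<open>j\<close> add up to less than \<open>2 ^ j\<close>, and above \<open>j\<close> the set
  \<open>x\<close> contains all that \<open>y\<close> contains.\<close>

lemma set_encode_lessI:
  assumes "finite x" "finite y" "j \<in> x" "j \<notin> y" "\<And>i. i \<in> y \<Longrightarrow> j < i \<Longrightarrow> i \<in> x"
  shows "set_encode y < set_encode x"
proof -
  have "y \<subseteq> {..<j} \<union> {i\<in>x. j < i}"
    using assms(4,5) by (metis (no_types, lifting) UnI1 UnI2 lessThan_iff linorder_neqE_nat mem_Collect_eq subsetI)
  then have "set_encode y \<le> (\<Sum>i\<in>{..<j} \<union> {i\<in>x. j < i}. 2 ^ i)"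
    unfolding set_encode_def using assms(1) by (intro sum_mono2) auto
  also have "\<dots> = (\<Sum>i<j. 2 ^ i) + (\<Sum>i\<in>{i\<in>x. j < i}. 2 ^ i)"
    using assms(1) by (intro sum.union_disjoint) auto
  also have "(\<Sum>i<j. 2 ^ i) < (2::nat) ^ j"
    by (simp add: lessThan_atLeast0 sum_power2)
  also have "2 ^ j + (\<Sum>i\<in>{i\<in>x. j < i}. 2 ^ i) = (\<Sum>i\<in>insert j {i\<in>x. j < i}. (2::nat) ^ i)"
    using assms(1) by (subst sum.insert) auto
  also have "\<dots> \<le> set_encode x"
    unfolding set_encode_def using assms(1,3) by (intro sum_mono2) auto
  finally show ?thesis by simp
qed

lemma simplicial_rank_encode:
  assumes "x \<subseteq> {..<N}"
  shows "simplicial_rank N x + set_encode x = card x * 2 ^ N"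
proof -
  have "simplicial_rank N x + set_encode x = (\<Sum>i\<in>x. (2 ^ N - 2 ^ i) + 2 ^ i)"
    by (simp add: simplicial_rank_def set_encode_def sum.distrib)
  also have "\<dots> = (\<Sum>i\<in>x. 2 ^ N)"
    using assms by (intro sum.cong) (auto simp: less_imp_le)
  finally show ?thesis by simp
qed

lemma set_encode_bound:
  assumes "x \<subseteq> {..<N}"
  shows "set_encode x < 2 ^ N"
proof -
  have "set_encode x \<le> (\<Sum>i<N. 2 ^ i)"
    unfolding set_encode_def using assms by (intro sum_mono2) auto
  also have "\<dots> < 2 ^ N" by (simp add: lessThan_atLeast0 sum_power2)
  finally show ?thesis .
qed

text \<open>The code stays below \<open>2 ^ N\<close>, so it cannot outweigh a difference in size
  and only breaks ties.\<close>

lemma simplicial_rank_le_iff: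
  assumes "x \<subseteq> {..<N}" "y \<subseteq> {..<N}"
  shows "simplicial_rank N x \<le> simplicial_rank N y \<longleftrightarrow>
    card x < card y \<or> card x = card y \<and> set_encode y \<le> set_encode x"
proof -
  have less: "simplicial_rank N u < simplicial_rank N v"
    if "card u < card v" "u \<subseteq> {..<N}" "v \<subseteq> {..<N}" for u v
  proof -
    have "(card u + 1) * 2 ^ N \<le> card v * 2 ^ N" using that by (intro mult_right_mono) auto
    then show ?thesis
      using simplicial_rank_encode[OF that(2)] simplicial_rank_encode[OF that(3)]
        set_encode_bound[OF that(3)] by (simp add: algebra_simps)
  qed
  consider "card x < card y" | "card y < card x" | "card x = card y" by linarith
  then show ?thesis
  proof cases
    case 3
    then show ?thesis
      using simplicial_rank_encode[OF assms(1)] simplicial_rank_encode[OF assms(2)] by auto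
  qed (use less[of x y] less[of y x] assms in auto)
qed

lemma simplicial_rank_inj:
  assumes "x \<subseteq> {..<N}" "y \<subseteq> {..<N}" "simplicial_rank N x = simplicial_rank N y"
  shows "x = y"
proof -
  have "set_encode x = set_encode y"
    using simplicial_rank_le_iff[OF assms(1,2)] simplicial_rank_le_iff[OF assms(2,1)] assms(3)
    by auto
  then show ?thesis
    using set_encode_eq[OF finite_subset[OF assms(1)] finite_subset[OF assms(2)]] by simp
qed

lemma simplicial_rank_insert:
  "finite x \<Longrightarrow> i \<notin> x \<Longrightarrow> simplicial_rank N (insert i x) = (2 ^ N - 2 ^ i) + simplicial_rank N x"
  by (simp add: simplicial_rank_def)

lemma simplicial_rank_mono:
  "finite y \<Longrightarrow> x \<subseteq> y \<Longrightarrow> simplicial_rank N x \<le> simplicial_rank N y"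
  unfolding simplicial_rank_def by (rule sum_mono2) auto

text \<open>For equal sizes the order is decided by the largest element \<open>j\<close> of the
  symmetric difference, which lies in \<open>x\<close>. Either \<open>j\<close> survives the removal
  and decides again, or \<open>j = Min x\<close> and both sets become equal.\<close>

lemma simplicial_rank_remove_Min_mono:
  assumes "x \<subseteq> {..<N}" "y \<subseteq> {..<N}" "x \<noteq> {}" "y \<noteq> {}"
    and le: "simplicial_rank N x \<le> simplicial_rank N y"
  shows "simplicial_rank N (x - {Min x}) \<le> simplicial_rank N (y - {Min y})"
proof -
  have fin: "finite x" "finite y" using assms(1,2) finite_subset by auto
  have Min: "Min x \<in> x" "Min y \<in> y" using fin assms(3,4) by auto
  have sub: "x - {Min x} \<subseteq> {..<N}" "y - {Min y} \<subseteq> {..<N}" using assms(1,2) by auto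
  have card: "card (x - {Min x}) = card x - 1" "card (y - {Min y}) = card y - 1" "card x > 0"
    using fin Min by (auto simp: card_gt_0_iff)
  consider "card x < card y" | "x = y" | "card x = card y" "x \<noteq> y" "set_encode y \<le> set_encode x"
    using le simplicial_rank_le_iff[OF assms(1,2)] by blast
  then show ?thesis
  proof cases
    case 1
    then show ?thesis using card simplicial_rank_le_iff[OF sub] by auto
  next
    case 2
    then show ?thesis by simp
  next
    case 3
    define j where "j = Max (sym_diff x y)"
    have fs: "finite (sym_diff x y)" using fin by auto
    have "sym_diff x y \<noteq> {}" using 3 by auto
    then have j: "j \<in> sym_diff x y" unfolding j_def by (rule Max_in[OF fs])
    have above: "i \<in> x \<longleftrightarrow> i \<in> y" if "j < i" for i
    proof (rule ccontr)
      assume "\<not> ?thesis"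
      then have "i \<in> sym_diff x y" by blast
      then show False using Max_ge[OF fs, of i] that unfolding j_def by simp
    qed
    have jx: "j \<in> x" "j \<notin> y"
      using j 3(3) set_encode_lessI[OF fin(2,1), of j] above by auto
    show ?thesis
    proof (cases "Min x = j")
      case True
      have "x - {Min x} \<subseteq> y - {Min y}"
      proof
        fix i assume i: "i \<in> x - {Min x}"
        then have "j < i" using True fin Min_le[OF fin(1), of i] by auto
        then have "i \<in> y" using above i by auto
        moreover have "i \<noteq> Min y"
        proof
          \<comment> \<open>Then all of \<open>y\<close> lies above \<open>j\<close>, hence in
            \<open>x - {j}\<close>, which has fewer elements than \<open>y\<close>.\<close>
          assume "i = Min y"
          then have "y \<subseteq> x - {j}"
            using \<open>j < i\<close> Min_le[OF fin(2)] above by fastforce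
          then have "card y \<le> card (x - {j})" using fin by (intro card_mono) auto
          then show False using card 3 True by simp
        qed
        ultimately show "i \<in> y - {Min y}" by simp
      qed
      then have "x - {Min x} = y - {Min y}"
        using fin card 3 by (intro card_subset_eq) auto
      then show ?thesis by simp
    next
      case False
      then have "Min x < j" using Min_le[OF fin(1) jx(1)] by simp
      then have "set_encode (y - {Min y}) < set_encode (x - {Min x})"
        using jx above fin by (intro set_encode_lessI[of _ _ j]) auto
      then show ?thesis using 3 card simplicial_rank_le_iff[OF sub] by auto
    qed
  qed
qed

section \<open>Initial segments of the simplicial order and their neighbourhoods\<close>

definition initial_segment :: "nat \<Rightarrow> nat set \<Rightarrow> nat set set \<Rightarrow> bool" where
  "initial_segment N A I \<longleftrightarrow> I \<subseteq> Pow A \<and>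
     (\<forall>y\<in>I. \<forall>x\<in>Pow A. simplicial_rank N x \<le> simplicial_rank N y \<longrightarrow> x \<in> I)"

lemma initial_segmentD:
  "initial_segment N A I \<Longrightarrow> y \<in> I \<Longrightarrow> x \<subseteq> A \<Longrightarrow>
    simplicial_rank N x \<le> simplicial_rank N y \<Longrightarrow> x \<in> I"
  by (auto simp: initial_segment_def)

lemma initial_segment_subset: "initial_segment N A I \<Longrightarrow> I \<subseteq> Pow A"
  by (auto simp: initial_segment_def)

lemma initial_segment_linear:
  assumes "initial_segment N A I" "initial_segment N A J"
  shows "I \<subseteq> J \<or> J \<subseteq> I"
proof (rule ccontr)
  assume "\<not> ?thesis"
  then obtain x y where "x \<in> I" "x \<notin> J" "y \<in> J" "y \<notin> I" by blast
  then show False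
    using initial_segmentD[OF assms(1), of x y] initial_segmentD[OF assms(2), of y x]
      initial_segment_subset[OF assms(1)] initial_segment_subset[OF assms(2)]
      linear[of "simplicial_rank N x" "simplicial_rank N y"] by blast
qed

lemma initial_segment_unique:
  assumes "finite A" "initial_segment N A I" "initial_segment N A J" "card I = card J"
  shows "I = J"
proof -
  have "finite I" "finite J"
    using assms(1) initial_segment_subset[OF assms(2)] initial_segment_subset[OF assms(3)]
      finite_subset[of _ "Pow A"] by simp_all
  then show ?thesis
    using initial_segment_linear[OF assms(2,3)] card_subset_eq[of J I] card_subset_eq[of I J]
      assms(4) by auto
qed

lemma initial_segment_exists:
  assumes "A \<subseteq> {..<N}" "k \<le> card (Pow A)"
  shows "\<exists>I. initial_segment N A I \<and> card I = k"
  using assms(2)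
proof (induction k)
  case 0
  show ?case by (intro exI[of _ "{}"]) (auto simp: initial_segment_def)
next
  case (Suc k)
  have finA: "finite (Pow A)" using assms(1) finite_subset by auto
  from Suc obtain I where I: "initial_segment N A I" "card I = k" by auto
  have finI: "finite I" using initial_segment_subset[OF I(1)] finA finite_subset by blast
  have "\<not> Pow A \<subseteq> I"
    using Suc.prems I(2) card_mono[OF finI, of "Pow A"] by auto
  then obtain x\<^sub>0 where "x\<^sub>0 \<in> Pow A - I" by blast
  then obtain x where x: "x \<in> Pow A - I"
    and min: "\<And>y. y \<in> Pow A - I \<Longrightarrow> simplicial_rank N x \<le> simplicial_rank N y"
    using ex_has_least_nat[of "\<lambda>x. x \<in> Pow A - I" x\<^sub>0 "simplicial_rank N"] by auto
  have "initial_segment N A (insert x I)"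
    unfolding initial_segment_def
  proof (intro conjI ballI impI)
    show "insert x I \<subseteq> Pow A" using x initial_segment_subset[OF I(1)] by auto
    fix y z assume y: "y \<in> insert x I" and z: "z \<in> Pow A"
      and le: "simplicial_rank N z \<le> simplicial_rank N y"
    show "z \<in> insert x I"
    proof (cases "z \<in> I")
      case False
      then have "simplicial_rank N x \<le> simplicial_rank N z" using z min by auto
      moreover have "y \<notin> I" using initial_segmentD[OF I(1), of y z] z le False by auto
      ultimately have "simplicial_rank N z = simplicial_rank N x" using y le by auto
      then show ?thesis using simplicial_rank_inj[of z N x] x z assms(1) by auto
    qed auto
  qed
  moreover have "card (insert x I) = Suc k" using I x finI by auto
  ultimately show ?case by blast
qed

text \<open>\<open>I - S\<close> and \<open>S - I\<close> have equal size, and every rank in the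
  second exceeds every rank in the first. The rank sum thus serves as a strictly decreasing
  potential for compression.\<close>

lemma initial_segment_sum_less:
  assumes "finite A" "initial_segment N A I" "S \<subseteq> Pow A" "card S = card I" "S \<noteq> I"
  shows "sum (simplicial_rank N) I < sum (simplicial_rank N) S"
proof -
  have fin: "finite I" "finite S"
    using assms(1,3) initial_segment_subset[OF assms(2)] finite_subset[of _ "Pow A"] by simp_all
  define D where "D = I - S"
  define E where "E = S - I"
  have finDE: "finite D" "finite E" using fin by (auto simp: D_def E_def)
  have cI: "card I = card (I \<inter> S) + card D" and sI: "sum f I = sum f (I \<inter> S) + sum f D"
    for f :: "nat set \<Rightarrow> nat"
    using fin unfolding D_def
    by (simp_all add: card_Int_Diff sum.Int_Diff[of I f S])
  have cS: "card S = card (I \<inter> S) + card E" and sS: "sum f S = sum f (I \<inter> S) + sum f E"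
    for f :: "nat set \<Rightarrow> nat"
    using fin unfolding E_def
    by (simp_all add: card_Int_Diff[of S I] sum.Int_Diff[of S f I] Int_commute)
  have card: "card D = card E" using cI cS assms(4) by simp
  have "D \<noteq> {}"
  proof
    assume "D = {}"
    then have "E = {}" using card finDE by simp
    then show False using \<open>D = {}\<close> assms(5) unfolding D_def E_def by blast
  qed
  then have pos: "0 < card D" using finDE by (simp add: card_gt_0_iff)
  define m where "m = Max (simplicial_rank N ` D)"
  have "sum (simplicial_rank N) D \<le> card D * m"
    using finDE unfolding m_def by (intro sum_bounded_above[where 'a=nat, simplified]) auto
  also have "\<dots> < card E * (m + 1)" using card pos by simp
  also have "\<dots> \<le> sum (simplicial_rank N) E"
  proof (intro sum_bounded_below[where 'a=nat, simplified])
    fix e assume e: "e \<in> E"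
    have "m \<in> simplicial_rank N ` D" unfolding m_def using finDE \<open>D \<noteq> {}\<close> by (intro Max_in) auto
    then obtain d where "d \<in> D" "m = simplicial_rank N d" by auto
    moreover have "\<not> simplicial_rank N e \<le> simplicial_rank N d"
      using e \<open>d \<in> D\<close> initial_segmentD[OF assms(2), of d e] assms(3) unfolding D_def E_def by auto
    ultimately show "m + 1 \<le> simplicial_rank N e" by simp
  qed
  finally show ?thesis using sI sS by simp
qed

text \<open>In the simplicial order \<open>y - {Min y}\<close> is the first neighbour of \<open>y\<close>.\<close>

lemma neighbourhood_initial_remove_Min:
  assumes "A \<subseteq> {..<N}" "initial_segment N A I" "y \<in> neighbourhood A I" "y \<noteq> {}"
  shows "y - {Min y} \<in> I"
proof -
  have y: "y \<subseteq> A" using assms(3) neighbourhood_subset by auto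
  have fin: "finite A" "finite y"
    using finite_subset[OF assms(1)] finite_subset[OF y] by simp_all
  have Min: "Min y \<in> y" using fin assms(4) by auto
  \<comment> \<open>The alternative \<open>y \<subseteq> z\<close> covers both \<open>z = y\<close>
    and \<open>z = insert a y\<close>.\<close>
  obtain z where z: "z \<in> I" and or: "y \<subseteq> z \<or> (\<exists>a\<in>y. z = y - {a})"
    using assms(3) unfolding neighbourhood_def by (cases "y \<in> I") auto
  have zA: "z \<subseteq> A" using z initial_segment_subset[OF assms(2)] by auto
  have "simplicial_rank N (y - {Min y}) \<le> simplicial_rank N z"
    using or
  proof
    assume "y \<subseteq> z"
    then show ?thesis using fin zA by (intro simplicial_rank_mono) (auto dest: finite_subset)
  next
    assume "\<exists>a\<in>y. z = y - {a}"
    then obtain a where a: "a \<in> y" "z = y - {a}" by blast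
    have rank: "simplicial_rank N y = (2 ^ N - 2 ^ b) + simplicial_rank N (y - {b})" if "b \<in> y" for b
      using simplicial_rank_insert[of "y - {b}" b N] that fin by (simp add: insert_absorb)
    \<comment> \<open>The weight of an element decreases as the element grows, so removing the least
      one lowers the rank most.\<close>
    have "2 ^ N - 2 ^ a \<le> (2::nat) ^ N - 2 ^ Min y"
      using a(1) fin by (intro diff_le_mono2 power_increasing) auto
    then show ?thesis
      using rank[OF a(1)] rank[OF Min] unfolding a(2) by linarith
  qed
  then show ?thesis using initial_segmentD[OF assms(2) z] y by blast
qed

text \<open>A nonempty \<open>y \<subseteq> A\<close> is in the neighbourhood exactly if
  \<open>y - {Min y}\<close> is in \<open>I\<close>, and removing minima respects the order. The
  empty set has no minimum and is treated apart.\<close>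

lemma initial_segment_neighbourhood:
  assumes "A \<subseteq> {..<N}" "initial_segment N A I"
  shows "initial_segment N A (neighbourhood A I)"
  unfolding initial_segment_def
proof (intro conjI ballI impI)
  show "neighbourhood A I \<subseteq> Pow A" by (rule neighbourhood_subset)
  fix y x assume y: "y \<in> neighbourhood A I" and x: "x \<in> Pow A"
    and le: "simplicial_rank N x \<le> simplicial_rank N y"
  have yA: "y \<subseteq> A" using y neighbourhood_subset by auto
  show "x \<in> neighbourhood A I"
  proof (cases "x = {}")
    case True
    obtain z where "z \<in> I" using y unfolding neighbourhood_def by auto
    then have "{} \<in> I" using initial_segmentD[OF assms(2), of z "{}"] by (auto simp: simplicial_rank_def)
    then show ?thesis using True by (auto simp: neighbourhood_def)
  next
    case False
    have fin: "finite x" using x finite_subset[OF assms(1)] finite_subset[of x A] by simp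
    have "y \<noteq> {}"
    proof
      assume "y = {}"
      then have "simplicial_rank N x = simplicial_rank N {}"
        using le by (simp add: simplicial_rank_def)
      then show False using simplicial_rank_inj[of x N "{}"] x assms(1) False by auto
    qed
    then have "y - {Min y} \<in> I" using neighbourhood_initial_remove_Min[OF assms y] by simp
    moreover have "simplicial_rank N (x - {Min x}) \<le> simplicial_rank N (y - {Min y})"
      using simplicial_rank_remove_Min_mono[of x N y] x yA assms(1) False \<open>y \<noteq> {}\<close> le by auto
    ultimately have "x - {Min x} \<in> I"
      using initial_segmentD[OF assms(2)] x by blast
    moreover have "Min x \<in> A" using x Min_in[OF fin False] by blast
    ultimately show ?thesis using x unfolding neighbourhood_def by auto
  qed
qed

section \<open>Harper's theorem\<close>

lemma sections_decompose:
  assumes "i \<in> A" "S \<subseteq> Pow A"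
  obtains P Q where "P \<subseteq> Pow (A - {i})" "Q \<subseteq> Pow (A - {i})" "S = P \<union> insert i ` Q"
proof
  show "S = {x\<in>S. i \<notin> x} \<union> insert i ` ((\<lambda>x. x - {i}) ` {x\<in>S. i \<in> x})"
    by (force simp: image_image insert_absorb)
qed (use assms in auto)

text \<open>Inserting \<open>i\<close> adds the same weight to every member of \<open>Q\<close>, so
  exchanging sections for others of equal size alters the total only through the sums over the
  sections.\<close>

lemma sum_sections:
  assumes "finite B" "i \<notin> B" "P \<subseteq> Pow B" "Q \<subseteq> Pow B"
  shows "sum (simplicial_rank N) (P \<union> insert i ` Q) =
    sum (simplicial_rank N) P + (card Q * (2 ^ N - 2 ^ i) + sum (simplicial_rank N) Q)"
proof -
  have fin: "finite P" "finite Q"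
    using assms finite_subset[of _ "Pow B"] by simp_all
  have inj: "inj_on (insert i) Q"
    using assms by (intro inj_onI) (subst (asm) insert_ident, auto)
  have "P \<inter> insert i ` Q = {}" using assms by auto
  then have "sum (simplicial_rank N) (P \<union> insert i ` Q) =
      sum (simplicial_rank N) P + sum (simplicial_rank N) (insert i ` Q)"
    using fin by (intro sum.union_disjoint) auto
  also have "sum (simplicial_rank N) (insert i ` Q) = (\<Sum>x\<in>Q. simplicial_rank N (insert i x))"
    using sum.reindex[OF inj] by simp
  also have "\<dots> = (\<Sum>x\<in>Q. (2 ^ N - 2 ^ i) + simplicial_rank N x)"
    using assms finite_subset[of _ B] by (intro sum.cong refl simplicial_rank_insert) auto
  finally show ?thesis by (simp add: sum.distrib)
qed

text \<open>Initial segments are nested, so their union is just the larger one.\<close>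

lemma card_Un_initial_segments_le:
  assumes "initial_segment N A I" "initial_segment N A J" "finite P" "finite Q"
    "card I \<le> card P" "card J \<le> card Q"
  shows "card (I \<union> J) \<le> card (P \<union> Q)"
proof -
  have "I \<union> J = I \<or> I \<union> J = J" using initial_segment_linear[OF assms(1,2)] by blast
  moreover have "card P \<le> card (P \<union> Q)" "card Q \<le> card (P \<union> Q)"
    using assms(3,4) by (auto intro: card_mono)
  ultimately show ?thesis using assms(5,6) by auto
qed

text \<open>By \<open>neighbourhood_sections\<close> the neighbourhood has the sections
  \<open>neighbourhood ?B P \<union> Q\<close> and \<open>neighbourhood ?B Q \<union> P\<close>.
  After compression both are unions of two initial segments, and each part is no larger than before,
  by \<open>isoperimetry\<close> one dimension lower.\<close>

lemma compress_sections:
  assumes A: "A \<subseteq> {..<N}" "i \<in> A" and P: "P \<subseteq> Pow (A - {i})" and Q: "Q \<subseteq> Pow (A - {i})"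
    and isoperimetry: "\<And>S I. S \<subseteq> Pow (A - {i}) \<Longrightarrow> initial_segment N (A - {i}) I \<Longrightarrow> card I = card S \<Longrightarrow>
      card (neighbourhood (A - {i}) I) \<le> card (neighbourhood (A - {i}) S)"
    and not_initial: "\<not> (initial_segment N (A - {i}) P \<and> initial_segment N (A - {i}) Q)"
  obtains S' where "S' \<subseteq> Pow A" "card S' = card (P \<union> insert i ` Q)"
    "card (neighbourhood A S') \<le> card (neighbourhood A (P \<union> insert i ` Q))"
    "sum (simplicial_rank N) S' < sum (simplicial_rank N) (P \<union> insert i ` Q)"
proof -
  let ?B = "A - {i}"
  have B: "?B \<subseteq> {..<N}" "finite ?B" "i \<notin> ?B" "insert i ?B = A"
    using A finite_subset[OF A(1)] by auto
  have "card P \<le> card (Pow ?B)" "card Q \<le> card (Pow ?B)"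
    using P Q B(2) by (simp_all add: card_mono del: card_Pow)
  then obtain I J where I: "initial_segment N ?B I" "card I = card P"
    and J: "initial_segment N ?B J" "card J = card Q"
    using initial_segment_exists[OF B(1)] by metis
  note sub = initial_segment_subset[OF I(1)] initial_segment_subset[OF J(1)]
  have fin: "finite P" "finite Q" "finite I" "finite J"
    using P Q sub B(2) finite_subset[of _ "Pow ?B"] by simp_all
  have nb: "neighbourhood A (X \<union> insert i ` Y) =
      (neighbourhood ?B X \<union> Y) \<union> insert i ` (neighbourhood ?B Y \<union> X)"
    "card ((neighbourhood ?B X \<union> Y) \<union> insert i ` (neighbourhood ?B Y \<union> X)) =
      card (neighbourhood ?B X \<union> Y) + card (neighbourhood ?B Y \<union> X)"
    if "X \<subseteq> Pow ?B" "Y \<subseteq> Pow ?B" for X Y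
  proof -
    show "neighbourhood A (X \<union> insert i ` Y) =
      (neighbourhood ?B X \<union> Y) \<union> insert i ` (neighbourhood ?B Y \<union> X)"
      using neighbourhood_sections[OF B(3) that] B(4) by simp
    show "card ((neighbourhood ?B X \<union> Y) \<union> insert i ` (neighbourhood ?B Y \<union> X)) =
      card (neighbourhood ?B X \<union> Y) + card (neighbourhood ?B Y \<union> X)"
      using that neighbourhood_subset[of ?B X] neighbourhood_subset[of ?B Y]
      by (intro card_sections[OF B(2,3)] Un_least)
  qed
  show ?thesis
  proof (rule that[of "I \<union> insert i ` J"])
    show "I \<union> insert i ` J \<subseteq> Pow A" using sub A(2) by auto
    show "card (I \<union> insert i ` J) = card (P \<union> insert i ` Q)"
      using I J card_sections[OF B(2,3) sub] card_sections[OF B(2,3) P Q] by simp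
    have "card (neighbourhood ?B I \<union> J) \<le> card (neighbourhood ?B P \<union> Q)"
      using I J fin B(2) isoperimetry[OF P I] finite_neighbourhood[OF B(2)]
      by (intro card_Un_initial_segments_le[OF initial_segment_neighbourhood[OF B(1) I(1)] J(1)]) auto
    moreover have "card (neighbourhood ?B J \<union> I) \<le> card (neighbourhood ?B Q \<union> P)"
      using I J fin B(2) isoperimetry[OF Q J] finite_neighbourhood[OF B(2)]
      by (intro card_Un_initial_segments_le[OF initial_segment_neighbourhood[OF B(1) J(1)] I(1)]) auto
    ultimately show "card (neighbourhood A (I \<union> insert i ` J)) \<le> card (neighbourhood A (P \<union> insert i ` Q))"
      unfolding nb[OF sub] nb[OF P Q] by (rule add_mono)
    let ?w = "sum (simplicial_rank N)"
    have "P = I \<or> ?w I < ?w P" "Q = J \<or> ?w J < ?w Q"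
      using initial_segment_sum_less[OF B(2) I(1) P I(2)[symmetric]]
        initial_segment_sum_less[OF B(2) J(1) Q J(2)[symmetric]] by blast+
    moreover have "P \<noteq> I \<or> Q \<noteq> J" using not_initial I(1) J(1) by blast
    ultimately have "?w I + ?w J < ?w P + ?w Q" by (elim disjE) simp_all
    then show "?w (I \<union> insert i ` J) < ?w (P \<union> insert i ` Q)"
      unfolding sum_sections[OF B(2,3) sub] sum_sections[OF B(2,3) P Q] J(2) by linarith
  qed
qed

text \<open>The family \<open>insert y L\<close> is the only one with initial sections that need not be an initial
  segment. Unless the dimension is at most 2, \<open>x\<close> contains \<open>Min A\<close>, so \<open>x\<close> is not of the form
  \<open>w - {Min w}\<close> and contributes no new neighbour to \<open>L\<close>.\<close>

lemma neighbourhood_exceptional: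
  assumes A: "A \<subseteq> {..<N}" and x: "x \<subseteq> A" and y: "y = A - x"
    and less: "simplicial_rank N x < simplicial_rank N y"
    and gap: "\<And>z. z \<subseteq> A \<Longrightarrow> simplicial_rank N x < simplicial_rank N z \<Longrightarrow>
      simplicial_rank N y \<le> simplicial_rank N z"
    and L: "L = {z \<in> Pow A. simplicial_rank N z < simplicial_rank N x}"
    and initial: "initial_segment N A (insert x L)"
  shows "neighbourhood A (insert x L) \<subseteq> neighbourhood A (insert y L)"
proof
  fix w assume w: "w \<in> neighbourhood A (insert x L)"
  have wA: "w \<subseteq> A" using w neighbourhood_subset by auto
  have fin: "finite A" "finite x" "finite w" "finite y"
    using finite_subset[OF A] finite_subset[OF x] finite_subset[OF wA] y by simp_all
  have sub: "x \<subseteq> {..<N}" "y \<subseteq> {..<N}" using A x y by auto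
  have "A \<noteq> {}" using less x y by auto
  define e where "e = Min A"
  have e: "e \<in> A" "\<And>a. a \<in> A \<Longrightarrow> e \<le> a" using fin(1) \<open>A \<noteq> {}\<close> by (simp_all add: e_def)
  show "w \<in> neighbourhood A (insert y L)"
  proof (cases "x = {}")
    case True
    \<comment> \<open>Here \<open>y = A\<close>, and no rank lies strictly between those of
      \<open>{}\<close> and \<open>A\<close>; so \<open>{e}\<close> must already be
      \<open>A\<close>, which is dimension 1.\<close>
    have "simplicial_rank N {} \<noteq> simplicial_rank N {e}"
      using simplicial_rank_inj[of "{}" N "{e}"] A e(1) by auto
    then have "simplicial_rank N x < simplicial_rank N {e}"
      using True by (simp add: simplicial_rank_def)
    then have "simplicial_rank N A \<le> simplicial_rank N {e}"
      using gap[of "{e}"] e(1) True y by simp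
    moreover have "simplicial_rank N {e} \<le> simplicial_rank N A"
      using e(1) by (intro simplicial_rank_mono[OF fin(1)]) simp
    ultimately have "simplicial_rank N {e} = simplicial_rank N A" by simp
    then have "A = {e}" using simplicial_rank_inj[of "{e}" N A] A e(1) by auto
    then have "y = {e}" "w = {} \<or> w = {e}" using wA y True by auto
    then show ?thesis using e(1) unfolding neighbourhood_def by auto
  next
    case False
    define f where "f = Min x"
    have f: "f \<in> x" "\<And>a. a \<in> x \<Longrightarrow> f \<le> a" using fin False by (simp_all add: f_def)
    have rank_empty: "simplicial_rank N {} < simplicial_rank N x"
      using simplicial_rank_inj[of "{}" N x] sub(1) False simplicial_rank_mono[OF fin(2), of "{}" N]
      by (metis empty_subsetI le_neq_implies_less)
    then have L_empty: "{} \<in> L" unfolding L by simp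
    show ?thesis
    proof (cases "e \<in> x")
      case True
      show ?thesis
      proof (cases "w = {}")
        case w_empty: False
        have "w - {Min w} \<in> insert x L"
          by (rule neighbourhood_initial_remove_Min[OF A initial w w_empty])
        moreover have "w - {Min w} \<noteq> x"
        proof
          assume eq: "w - {Min w} = x"
          then have "e \<in> w" "e \<noteq> Min w" using True by auto
          moreover have "Min w \<in> w" using fin w_empty by auto
          ultimately show False using e(2)[of "Min w"] Min_le[OF fin(3), of e] wA by auto
        qed
        ultimately have "w - {Min w} \<in> L" by blast
        moreover have "Min w \<in> A" using Min_in[OF fin(3) w_empty] wA by blast
        ultimately show ?thesis using wA unfolding neighbourhood_def by blast
      qed (use L_empty in \<open>auto simp: neighbourhood_def\<close>)
    next
      case notin: False
      have "e < f" using e(2)[of f] f(1) x notin by (cases "e = f") force+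
      \<comment> \<open>\<open>z\<close> has the size of \<open>x\<close> and a larger rank, so by
        \<open>gap\<close> the set \<open>y\<close> comes no later than \<open>z\<close> and has
        that size too. The largest element \<open>j\<close> of \<open>A\<close> then forces
        \<open>x = {j}\<close> and \<open>y = {e}\<close>, which is dimension 2.\<close>
      define z where "z = insert e (x - {f})"
      have zA: "z \<subseteq> A" using e(1) x by (auto simp: z_def)
      have cz: "card z = card x"
        using fin notin card.remove[OF fin(2) f(1)] by (simp add: z_def)
      have subz: "z \<subseteq> {..<N}" using zA A by auto
      have "set_encode z < set_encode x"
        using fin f e(1) notin \<open>e < f\<close> finite_subset[OF zA]
        by (intro set_encode_lessI[of _ _ f]) (auto simp: z_def)
      then have "\<not> simplicial_rank N z \<le> simplicial_rank N x"
        using simplicial_rank_le_iff[OF subz sub(1)] cz by simp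
      then have yz: "simplicial_rank N y \<le> simplicial_rank N z" using gap[OF zA] by simp
      have cy: "card y = card x"
        using simplicial_rank_le_iff[OF sub] simplicial_rank_le_iff[OF sub(2) subz] cz yz less by linarith
      have enc: "set_encode z \<le> set_encode y"
        using simplicial_rank_le_iff[OF sub(2) subz] cy cz yz by simp
      have "\<not> simplicial_rank N y \<le> simplicial_rank N x" using less by simp
      then have encxy: "set_encode y < set_encode x"
        using simplicial_rank_le_iff[OF sub(2,1)] cy by simp
      define j where "j = Max A"
      have j: "j \<in> A" "\<And>a. a \<in> A \<Longrightarrow> a \<le> j" using fin(1) \<open>A \<noteq> {}\<close> by (simp_all add: j_def)
      have above: "\<not> j < a" if "a \<in> A" for a using j(2)[OF that] by simp
      have jx: "j \<in> x"
      proof (rule ccontr)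
        assume "j \<notin> x"
        then have "set_encode x < set_encode y"
          using j(1) x y fin above by (intro set_encode_lessI[of _ _ j]) auto
        then show False using encxy by simp
      qed
      have "f = j"
      proof (rule ccontr)
        assume "f \<noteq> j"
        then have "set_encode y < set_encode z"
          using jx y fin(2,4) above by (intro set_encode_lessI[of _ _ j]) (auto simp: z_def)
        then show False using enc by simp
      qed
      then have "a = j" if "a \<in> x" for a using f(2)[OF that] j(2)[of a] that x by auto
      then have xj: "x = {j}" using jx by blast
      then have "card y = 1" using cy by simp
      moreover have "e \<in> y" using y e(1) notin by simp
      ultimately have ye: "y = {e}" by (metis card_1_singletonE singletonD)
      then have "A = {e, j}" using y xj x by auto
      then have "w - {j} = {} \<or> w - {j} = {e}" using wA by blast
      then have "w - {j} \<in> insert y L" using L_empty ye by (metis insert_iff)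
      then show ?thesis using wA j(1) unfolding neighbourhood_def by blast
    qed
  qed
qed

text \<open>Harper's theorem for distance 1. The induction hypothesis for \<open>A - {i}\<close> is
  what compression at \<open>i\<close> consumes.\<close>

theorem card_neighbourhood_initial_segment_le:
  assumes "A \<subseteq> {..<N}" "S \<subseteq> Pow A" "initial_segment N A I" "card I = card S"
  shows "card (neighbourhood A I) \<le> card (neighbourhood A S)"
  using assms
proof (induction "card A" arbitrary: A S I rule: less_induct)
  case less
  note A = less.prems(1)
  have finA: "finite A" using finite_subset[OF A] by simp
  let ?P = "\<lambda>T. T \<subseteq> Pow A \<and> card T = card S \<and> card (neighbourhood A T) \<le> card (neighbourhood A S)"
  have "?P S" using less.prems(2) by simp
  then obtain T where T: "?P T"
    and min: "\<And>U. ?P U \<Longrightarrow> sum (simplicial_rank N) T \<le> sum (simplicial_rank N) U"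
    using ex_has_least_nat[of ?P S "sum (simplicial_rank N)"] by blast
  \<comment> \<open>If \<open>u\<close> and \<open>v\<close> agree at some \<open>i\<close>, they
    belong to the same section at \<open>i\<close>. That section is initial by minimality of
    \<open>T\<close>, so \<open>u\<close> could not be missing. Hence only complementary pairs can
    violate initiality.\<close>
  have compl: "u = A - v"
    if v: "v \<in> T" and u: "u \<subseteq> A" "u \<notin> T" "simplicial_rank N u \<le> simplicial_rank N v" for u v
  proof (rule ccontr)
    assume "u \<noteq> A - v"
    moreover have vA: "v \<subseteq> A" using v T by auto
    ultimately obtain i where i: "i \<in> A" "i \<in> u \<longleftrightarrow> i \<in> v" using u(1) by blast
    obtain P Q where PQ: "P \<subseteq> Pow (A - {i})" "Q \<subseteq> Pow (A - {i})" "T = P \<union> insert i ` Q"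
      using sections_decompose[OF i(1)] T by blast
    have cardB: "card (A - {i}) < card A" using finA i(1) by (rule card_Diff1_less)
    have isoperimetry: "card (neighbourhood (A - {i}) I') \<le> card (neighbourhood (A - {i}) S')"
      if "S' \<subseteq> Pow (A - {i})" "initial_segment N (A - {i}) I'" "card I' = card S'" for S' I'
      using less.hyps[OF cardB _ that] A by blast
    have initial: "initial_segment N (A - {i}) P" "initial_segment N (A - {i}) Q"
    proof -
      have "initial_segment N (A - {i}) P \<and> initial_segment N (A - {i}) Q"
      proof (rule ccontr)
        assume "\<not> ?thesis"
        then obtain S' where "S' \<subseteq> Pow A" "card S' = card T"
          "card (neighbourhood A S') \<le> card (neighbourhood A T)"
          "sum (simplicial_rank N) S' < sum (simplicial_rank N) T"
          using compress_sections[OF A i(1) PQ(1,2) isoperimetry] unfolding PQ(3) by blast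
        then show False using min[of S'] T by simp
      qed
      then show "initial_segment N (A - {i}) P" "initial_segment N (A - {i}) Q" by auto
    qed
    show False
    proof (cases "i \<in> v")
      case True
      have ins: "insert i (v - {i}) = v" "insert i (u - {i}) = u" using True i(2) by auto
      have "v \<notin> P" using PQ(1) True by auto
      then have "insert i (v - {i}) \<in> insert i ` Q" using v ins(1) unfolding PQ(3) by simp
      then have "v - {i} \<in> Q"
        using insert_mem_image_insert_iff[OF _ PQ(2), of i "v - {i}"] vA by blast
      moreover have "simplicial_rank N (u - {i}) \<le> simplicial_rank N (v - {i})"
        using simplicial_rank_insert[of "v - {i}" i N] simplicial_rank_insert[of "u - {i}" i N]
          ins u(3) finite_subset[OF u(1) finA] finite_subset[OF vA finA] by simp
      moreover have "u - {i} \<subseteq> A - {i}" using u(1) by blast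
      ultimately have "u - {i} \<in> Q"
        using initial_segmentD[OF initial(2), of "v - {i}" "u - {i}"] by simp
      then have "insert i (u - {i}) \<in> T" unfolding PQ(3) by blast
      then have "u \<in> T" using ins(2) by simp
      then show False using u(2) by simp
    next
      case False
      then have "v \<in> P" using v unfolding PQ(3) by auto
      moreover have "u \<subseteq> A - {i}" using False i(2) u(1) by auto
      ultimately have "u \<in> P" using initial_segmentD[OF initial(1), of v u] u(3) by simp
      then show False using u(2) unfolding PQ(3) by simp
    qed
  qed
  have "card (neighbourhood A I) \<le> card (neighbourhood A T)"
  proof (cases "initial_segment N A T")
    case True
    then have "T = I" using initial_segment_unique[OF finA True less.prems(3)] T less.prems(4) by simp
    then show ?thesis by simp
  next
    case False
    then obtain x y where y: "y \<in> T" and x: "x \<subseteq> A" "x \<notin> T"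
      and le: "simplicial_rank N x \<le> simplicial_rank N y"
      using T unfolding initial_segment_def by blast
    have yA: "y \<subseteq> A" using y T by auto
    have xy: "x = A - y" using compl[OF y x le] .
    then have yx: "y = A - x" using yA by auto
    have "simplicial_rank N x \<noteq> simplicial_rank N y"
      using simplicial_rank_inj[of x N y] x y yA A by blast
    then have lt: "simplicial_rank N x < simplicial_rank N y" using le by simp
    define L where "L = {z \<in> Pow A. simplicial_rank N z < simplicial_rank N x}"
    \<comment> \<open>A member of \<open>T\<close> ranked no lower than \<open>x\<close> is the
      complement of \<open>x\<close>, hence \<open>y\<close>. A set missing from \<open>T\<close>
      but ranked below \<open>x\<close> would be the complement of \<open>y\<close>, hence
      \<open>x\<close> itself.\<close>
    have TL: "T = insert y L"
    proof (intro subset_antisym subsetI)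
      fix z assume z: "z \<in> T"
      then have zA: "z \<subseteq> A" using T by auto
      show "z \<in> insert y L"
      proof (cases "simplicial_rank N z < simplicial_rank N x")
        case False
        then have "x = A - z" using compl[OF z x] by simp
        then have "z = y" using zA yx by auto
        then show ?thesis by simp
      qed (use zA in \<open>simp add: L_def\<close>)
    next
      fix z assume z: "z \<in> insert y L"
      show "z \<in> T"
      proof (rule ccontr)
        assume "z \<notin> T"
        then have "z \<in> L" using z y by auto
        then have zL: "z \<subseteq> A" "simplicial_rank N z < simplicial_rank N x" by (simp_all add: L_def)
        then have "z = x" using compl[OF y zL(1) \<open>z \<notin> T\<close>] xy le by simp
        then show False using zL(2) by simp
      qed
    qed
    have gap: "simplicial_rank N y \<le> simplicial_rank N z"
      if z: "z \<subseteq> A" "simplicial_rank N x < simplicial_rank N z" for z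
    proof (cases "z \<in> T")
      case True
      then have "z \<in> L \<or> z = y" using TL by auto
      then show ?thesis using z(2) by (auto simp: L_def)
    next
      case nz: False
      have "z \<noteq> x" using z(2) by auto
      then show ?thesis
        using compl[OF y z(1) nz] xy linear[of "simplicial_rank N z" "simplicial_rank N y"] by blast
    qed
    have initial: "initial_segment N A (insert x L)"
      unfolding initial_segment_def
    proof (intro conjI ballI impI)
      show "insert x L \<subseteq> Pow A" using x(1) by (auto simp: L_def)
      fix v u assume v: "v \<in> insert x L" and u: "u \<in> Pow A"
        and "simplicial_rank N u \<le> simplicial_rank N v"
      then have "simplicial_rank N u < simplicial_rank N x \<or> simplicial_rank N u = simplicial_rank N x"
        by (auto simp: L_def)
      then show "u \<in> insert x L"
        using u x(1) A simplicial_rank_inj[of u N x] by (auto simp: L_def)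
    qed
    have "finite L" unfolding L_def using finA by simp
    moreover have "x \<notin> L" "y \<notin> L" using lt by (auto simp: L_def)
    ultimately have "card (insert x L) = card T" using TL by simp
    \<comment> \<open>Exchanging \<open>y\<close> for \<open>x\<close> keeps the size and gives an
      initial segment, and there is only one of each size.\<close>
    then have "I = insert x L"
      using initial_segment_unique[OF finA less.prems(3) initial] T less.prems(4) by simp
    then show ?thesis
      using neighbourhood_exceptional[OF A x(1) yx lt gap L_def initial] TL
        finite_neighbourhood[OF finA] card_mono by metis
  qed
  then show ?case using T by simp
qed

section \<open>Iterated neighbourhoods and Hamming balls\<close>

lemma iterated_neighbourhood_subset:
  "S \<subseteq> Pow A \<Longrightarrow> (neighbourhood A ^^ m) S \<subseteq> Pow A"
  using neighbourhood_subset[of A "(neighbourhood A ^^ (m - 1)) S"] by (cases m) simp_all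

text \<open>Harper's theorem compares families of equal size. Therefore each step cuts the iterated
  neighbourhood down to a subfamily \<open>U\<close> of the size of \<open>F (t + m)\<close> and
  returns to the whole by monotonicity. \<open>F\<close> will be a sequence of balls.\<close>

lemma card_iterated_neighbourhood_ge:
  assumes A: "A \<subseteq> {..<N}" and S: "S \<subseteq> Pow A"
    and initial: "\<And>t. initial_segment N A (F t)"
    and step: "\<And>t. F (Suc t) \<subseteq> neighbourhood A (F t)"
    and card: "card (F t) \<le> card S"
  shows "card (F (t + m)) \<le> card ((neighbourhood A ^^ m) S)"
proof (induction m)
  case 0
  show ?case using card by simp
next
  case (Suc m)
  let ?T = "(neighbourhood A ^^ m) S"
  have finA: "finite A" using finite_subset[OF A] by simp
  have T: "?T \<subseteq> Pow A" using S by (rule iterated_neighbourhood_subset)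
  obtain U where U: "U \<subseteq> ?T" "card U = card (F (t + m))"
    using obtain_subset_with_card_n[OF Suc.IH] by blast
  have "card (F (t + Suc m)) \<le> card (neighbourhood A (F (t + m)))"
    using step[of "t + m"] finite_neighbourhood[OF finA] by (auto intro: card_mono)
  also have "\<dots> \<le> card (neighbourhood A U)"
    using U T by (intro card_neighbourhood_initial_segment_le[OF A _ initial]) auto
  also have "\<dots> \<le> card (neighbourhood A ?T)"
    using U(1) by (intro card_mono finite_neighbourhood[OF finA] neighbourhood_mono)
  finally show ?case by simp
qed

section \<open>Hamming balls as initial segments, and their sizes\<close>

lemma initial_segment_ball:
  assumes "A \<subseteq> {..<N}"
  shows "initial_segment N A {x \<in> Pow A. card x \<le> t}"
  unfolding initial_segment_def
proof (intro conjI ballI impI)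
  fix y x assume y: "y \<in> {x \<in> Pow A. card x \<le> t}" and x: "x \<in> Pow A"
    and le: "simplicial_rank N x \<le> simplicial_rank N y"
  have "x \<subseteq> {..<N}" "y \<subseteq> {..<N}" using x y assms by auto
  then have "card x \<le> card y" using le simplicial_rank_le_iff by auto
  then show "x \<in> {x \<in> Pow A. card x \<le> t}" using x y by simp
qed auto

text \<open>Treats both kinds of ball at once: \<open>C = {}\<close> for odd dimension,
  \<open>C = {n}\<close> for even dimension. Removing an element outside \<open>C\<close> brings a
  set one step inwards.\<close>

lemma neighbourhood_ball:
  assumes "finite A"
  shows "{x \<in> Pow A. card (x - C) \<le> Suc t} \<subseteq> neighbourhood A {x \<in> Pow A. card (x - C) \<le> t}"
proof
  fix x assume x: "x \<in> {x \<in> Pow A. card (x - C) \<le> Suc t}"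
  then have fin: "finite x" using assms finite_subset by auto
  show "x \<in> neighbourhood A {x \<in> Pow A. card (x - C) \<le> t}"
  proof (cases "x - C = {}")
    case True
    then have "card (x - C) = 0" by (simp only: card.empty)
    then show ?thesis using x by (simp add: neighbourhood_def)
  next
    case False
    then obtain a where a: "a \<in> x - C" by blast
    have "x - {a} - C = x - C - {a}" by blast
    then have "card (x - {a} - C) = card (x - C) - 1" using card_Diff_singleton[OF a] by simp
    then have "x - {a} \<in> {x \<in> Pow A. card (x - C) \<le> t}" using x by auto
    then show ?thesis using x a unfolding neighbourhood_def by blast
  qed
qed

text \<open>The family consists of the sets of size at most \<open>t\<close> and those of size
  \<open>t + 1\<close> that contain \<open>a\<close>. Since \<open>a\<close> is the largest element
  of \<open>A\<close>, the latter come first among the sets of their size.\<close>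

lemma initial_segment_ball_Diff_Max:
  assumes A: "A \<subseteq> {..<N}" and a: "a \<in> A" "\<And>b. b \<in> A \<Longrightarrow> b \<le> a"
  shows "initial_segment N A {x \<in> Pow A. card (x - {a}) \<le> t}"
  unfolding initial_segment_def
proof (intro conjI ballI impI)
  fix y x assume y: "y \<in> {x \<in> Pow A. card (x - {a}) \<le> t}" and x: "x \<in> Pow A"
    and le: "simplicial_rank N x \<le> simplicial_rank N y"
  have sub: "x \<subseteq> {..<N}" "y \<subseteq> {..<N}" using x y A by auto
  have fin: "finite x" "finite y"
    using finite_subset[OF sub(1)] finite_subset[OF sub(2)] by simp_all
  have iff: "card x < card y \<or> card x = card y \<and> set_encode y \<le> set_encode x"
    using le simplicial_rank_le_iff[OF sub] by simp
  have y_le: "card y \<le> t + (if a \<in> y then 1 else 0)"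
    using y fin by (auto simp: card_Diff_singleton_if split: if_splits)
  have "card (x - {a}) \<le> t"
  proof (cases "card x \<le> t")
    case True
    then show ?thesis using card_Diff1_le[of x a] by linarith
  next
    case False
    then have ay: "a \<in> y" "card x = card y" "set_encode y \<le> set_encode x" "card x = t + 1"
      using iff y_le by (auto split: if_splits)
    have "a \<in> x"
    proof (rule ccontr)
      assume "a \<notin> x"
      then have "set_encode x < set_encode y"
        using fin ay(1) x a(2) by (intro set_encode_lessI[of _ _ a]) (auto dest: leD)
      then show False using ay(3) by simp
    qed
    then show ?thesis using ay(4) by simp
  qed
  then show "x \<in> {x \<in> Pow A. card (x - {a}) \<le> t}" using x by simp
qed auto

lemma card_ball:
  assumes "finite A"
  shows "card {x \<in> Pow A. card x \<le> t} = (\<Sum>i\<le>t. card A choose i)"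
proof -
  have "{x \<in> Pow A. card x \<le> t} = (\<Union>i\<le>t. {x. x \<subseteq> A \<and> card x = i})" by auto
  also have "card \<dots> = (\<Sum>i\<le>t. card {x. x \<subseteq> A \<and> card x = i})"
    using assms by (intro card_UN_disjoint) auto
  finally show ?thesis using n_subsets[OF assms] by simp
qed

lemma card_ball_Diff:
  assumes "finite A" "a \<in> A"
  shows "card {x \<in> Pow A. card (x - {a}) \<le> t} = 2 * (\<Sum>i\<le>t. (card A - 1) choose i)"
proof -
  let ?P = "{x \<in> Pow (A - {a}). card x \<le> t}"
  have "{x \<in> Pow A. card (x - {a}) \<le> t} = ?P \<union> insert a ` ?P"
  proof (intro subset_antisym subsetI)
    fix x assume x: "x \<in> {x \<in> Pow A. card (x - {a}) \<le> t}"
    show "x \<in> ?P \<union> insert a ` ?P"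
    proof (cases "a \<in> x")
      case True
      then have "x = insert a (x - {a})" "x - {a} \<in> ?P" using x by auto
      then show ?thesis by blast
    next
      case False
      then show ?thesis using x by (auto simp: Diff_insert0)
    qed
  next
    fix x assume x: "x \<in> ?P \<union> insert a ` ?P"
    then obtain z where z: "z \<in> ?P" "x = z \<or> x = insert a z" by blast
    then have "x - {a} = z" by auto
    then show "x \<in> {x \<in> Pow A. card (x - {a}) \<le> t}" using z assms(2) by auto
  qed
  moreover have "?P \<subseteq> Pow (A - {a})" by blast
  then have "card (?P \<union> insert a ` ?P) = card ?P + card ?P"
    using assms(1) by (intro card_sections[of "A - {a}"]) simp_all
  moreover have "card ?P = (\<Sum>i\<le>t. (card A - 1) choose i)"
    using card_ball[of "A - {a}" t] assms by simp
  ultimately show ?thesis by simp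
qed

lemma iterated_neighbourhood_dist:
  assumes "finite A" "S \<subseteq> Pow A" "x \<in> (neighbourhood A ^^ m) S"
  shows "\<exists>s\<in>S. card (sym_diff x s) \<le> m"
  using assms(3)
proof (induction m arbitrary: x)
  case 0
  then show ?case by (intro bexI[of _ x]) auto
next
  case (Suc m)
  let ?T = "(neighbourhood A ^^ m) S"
  have x: "x \<in> neighbourhood A ?T" using Suc.prems by simp
  \<comment> \<open>Inclusion in \<open>{a}\<close> rather than equality admits the case that
    \<open>x\<close> is itself in \<open>?T\<close>.\<close>
  then obtain a z where z: "z \<in> ?T" "sym_diff x z \<subseteq> {a}"
    unfolding neighbourhood_def by blast
  obtain s where s: "s \<in> S" "card (sym_diff z s) \<le> m" using Suc.IH[OF z(1)] by blast
  have "z \<subseteq> A" using z(1) iterated_neighbourhood_subset[OF assms(2)] by blast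
  then have "sym_diff z s \<subseteq> A" using s(1) assms(2) by auto
  then have fin: "finite (sym_diff z s)" using assms(1) by (rule finite_subset)
  have "card (sym_diff x s) \<le> card (insert a (sym_diff z s))"
    using fin z(2) by (intro card_mono) auto
  also have "\<dots> \<le> Suc m" using s(2) fin by (simp add: card_insert_if)
  finally show ?case using s(1) by blast
qed

section \<open>Colorings\<close>

text \<open>The hypothesis \<open>isoperimetry\<close> isolates what depends on the parity of
  \<open>n\<close>: any \<open>r\<close> sets must reach half of the cube within
  \<open>n - p - 1\<close> steps.\<close>

lemma b_coloring_hypercube_power_le:
  assumes b: "b_coloring (hypercube_power n p) k c" and "p < n" "0 < r"
    and isoperimetry: "\<And>S. S \<subseteq> Pow {1..n} \<Longrightarrow> r \<le> card S \<Longrightarrow>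
      2 ^ (n - 1) \<le> card ((neighbourhood {1..n} ^^ (n - p - 1)) S)"
  shows "int k \<le> 2 ^ (n - 1) + \<lceil>real r / 2\<rceil> - 1"
proof (rule ccontr)
  assume "\<not> ?thesis"
  then have k: "int (2 ^ (n - 1)) + \<lceil>real r / 2\<rceil> \<le> int k" by simp
  have pow: "(2::nat) ^ n = 2 * 2 ^ (n - 1)"
    using \<open>p < n\<close> by (metis gr_implies_not0 power_eq_if)
  have k_gt: "2 ^ (n - 1) < k"
  proof -
    have "0 < \<lceil>real r / 2\<rceil>" using \<open>0 < r\<close> by simp
    then have "int (2 ^ (n - 1)) < int k" using k by linarith
    then show ?thesis by (rule of_nat_less_imp_less)
  qed
  have k_ge: "2 ^ n + r \<le> 2 * k"
  proof -
    have "real r \<le> 2 * real_of_int \<lceil>real r / 2\<rceil>" by linarith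
    then have "int r \<le> 2 * \<lceil>real r / 2\<rceil>" by linarith
    then have "2 * int (2 ^ (n - 1)) + int r \<le> 2 * int k" using k by linarith
    then have "int (2 * 2 ^ (n - 1) + r) \<le> int (2 * k)"
      unfolding of_nat_add of_nat_mult of_nat_numeral .
    then show ?thesis unfolding pow by (simp only: of_nat_le_iff)
  qed
  let ?A = "{1..n}"
  define C where "C i = {x \<in> Pow ?A. c x = i}" for i
  have c_less: "c x < k" if "x \<in> Pow ?A" for x
    using b that unfolding b_coloring_def proper_coloring_def hypercube_power_def by auto
  have "\<forall>i\<in>{..<k}. \<exists>v. v \<in> Pow ?A \<and> c v = i \<and>
      (\<forall>j<k. j \<noteq> i \<longrightarrow> (\<exists>w\<in>Pow ?A. c w = j \<and> card (sym_diff v w) \<le> p))"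
  proof
    fix i assume "i \<in> {..<k}"
    then obtain v where v: "v \<in> Pow ?A" "c v = i"
      and adj: "\<forall>j<k. j \<noteq> i \<longrightarrow> (\<exists>w\<in>Pow ?A. c w = j \<and> (v, w) \<in> parcs (hypercube_power n p))"
      using b unfolding b_coloring_def by (auto simp: hypercube_power_def)
    have "card (sym_diff v w) \<le> p" if "(v, w) \<in> parcs (hypercube_power n p)" for w
      using that by (simp add: hypercube_power_def)
    then show "\<exists>v. v \<in> Pow ?A \<and> c v = i \<and>
        (\<forall>j<k. j \<noteq> i \<longrightarrow> (\<exists>w\<in>Pow ?A. c w = j \<and> card (sym_diff v w) \<le> p))"
      using v adj by blast
  qed
  from bchoice[OF this] obtain v where "\<forall>i\<in>{..<k}. v i \<in> Pow ?A \<and> c (v i) = i \<and>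
      (\<forall>j<k. j \<noteq> i \<longrightarrow> (\<exists>w\<in>Pow ?A. c w = j \<and> card (sym_diff (v i) w) \<le> p))" ..
  then have v: "\<And>i. i < k \<Longrightarrow> v i \<in> Pow ?A" "\<And>i. i < k \<Longrightarrow> c (v i) = i"
    and dominating: "\<And>i j. i < k \<Longrightarrow> j < k \<Longrightarrow> j \<noteq> i \<Longrightarrow>
      \<exists>w\<in>Pow ?A. c w = j \<and> card (sym_diff (v i) w) \<le> p"
    by simp_all
  have inj: "inj_on v {..<k}" using v(2) by (metis inj_onI lessThan_iff)
  define D where "D = {i. i < k \<and> card (C i) = 1}"
  have D: "D \<subseteq> {..<k}" by (auto simp: D_def)
  have finC: "finite (C i)" for i by (simp add: C_def)
  \<comment> \<open>Only singleton classes fall short of two vertices, each by one. Summation gives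
    \<open>2 * k \<le> 2 ^ n + card D\<close>, which against \<open>k_ge\<close> yields
    \<open>r \<le> card D\<close>.\<close>
  have "2 \<le> card (C i) + (if i \<in> D then 1 else 0)" if "i < k" for i
  proof -
    have "v i \<in> C i" using v that by (simp add: C_def)
    then have "card (C i) \<noteq> 0" using finC by auto
    then show ?thesis using that by (auto simp: D_def)
  qed
  then have "(\<Sum>i<k. 2) \<le> (\<Sum>i<k. card (C i) + (if i \<in> D then 1 else 0))"
    by (intro sum_mono) auto
  also have "\<dots> = (\<Sum>i<k. card (C i)) + card D"
    using D by (simp add: sum.distrib sum.If_cases Int_absorb1)
  also have "(\<Sum>i<k. card (C i)) = card (\<Union>i<k. C i)"
    using finC by (intro card_UN_disjoint[symmetric]) (auto simp: C_def)
  also have "(\<Union>i<k. C i) = Pow ?A" using c_less by (auto simp: C_def)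
  finally have "r \<le> card D" using k_ge by (simp add: card_Pow)
  then have rS: "r \<le> card (v ` D)" using card_image[OF inj_on_subset[OF inj D]] by simp
  have S: "v ` D \<subseteq> Pow ?A" using v(1) D by auto
  \<comment> \<open>A dominating vertex \<open>v j\<close> needs a neighbour in the class of
    \<open>i\<close>, and \<open>v i\<close> is the only vertex there.\<close>
  have dist: "card (sym_diff (v j) (v i)) \<le> p" if iD: "i \<in> D" and jk: "j < k" for i j
  proof (cases "j = i")
    case False
    have i: "i < k" "card (C i) = 1" using iD by (auto simp: D_def)
    obtain w where w: "w \<in> C i" "card (sym_diff (v j) w) \<le> p"
      using dominating[OF jk i(1)] False unfolding C_def by blast
    moreover have "v i \<in> C i" using v i(1) by (simp add: C_def)
    ultimately have "w = v i" using i(2) by (metis card_1_singletonE singletonD)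
    then show ?thesis using w(2) by simp
  qed simp
  define M where "M = (neighbourhood ?A ^^ (n - p - 1)) (v ` D)"
  define U where "U = (\<lambda>j. ?A - v j) ` {..<k}"
  have "inj_on (\<lambda>j. ?A - v j) {..<k}"
  proof (rule inj_onI)
    fix i j assume ij: "i \<in> {..<k}" "j \<in> {..<k}" "?A - v i = ?A - v j"
    then have "v i = v j" using v(1)[of i] v(1)[of j] by auto
    then show "i = j" using inj_onD[OF inj] ij by blast
  qed
  then have cU: "card U = k" unfolding U_def by (simp add: card_image)
  \<comment> \<open>Complementing \<open>v j\<close> turns distance at most \<open>p\<close> from
    \<open>v i\<close> into distance at least \<open>n - p\<close>, just beyond the
    \<open>n - p - 1\<close> steps that build \<open>M\<close>.\<close>
  have "M \<inter> U = {}"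
  proof (rule ccontr)
    assume "M \<inter> U \<noteq> {}"
    then obtain j where j: "j < k" "?A - v j \<in> M" unfolding U_def by blast
    then obtain i where i: "i \<in> D" "card (sym_diff (?A - v j) (v i)) \<le> n - p - 1"
      using iterated_neighbourhood_dist[OF _ S, of "?A - v j"] unfolding M_def by auto
    have sub: "v i \<subseteq> ?A" "v j \<subseteq> ?A" using v(1) j(1) i(1) D by auto
    then have "sym_diff (?A - v j) (v i) = ?A - sym_diff (v j) (v i)" by auto
    moreover have "sym_diff (v j) (v i) \<subseteq> ?A" using sub by blast
    ultimately have "card (sym_diff (?A - v j) (v i)) = n - card (sym_diff (v j) (v i))"
      using card_Diff_subset[of "sym_diff (v j) (v i)" ?A] finite_subset[of _ ?A] by simp
    then show False using dist[OF i(1) j(1)] i(2) \<open>p < n\<close> by linarith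
  qed
  moreover have MU: "M \<subseteq> Pow ?A" "U \<subseteq> Pow ?A"
    using iterated_neighbourhood_subset[OF S] unfolding M_def U_def by auto
  ultimately have "card M + card U = card (M \<union> U)"
    by (intro card_Un_disjoint[symmetric]) (auto intro: finite_subset)
  also have "\<dots> \<le> card (Pow ?A)" using MU by (intro card_mono) auto
  finally have "card M + k \<le> 2 ^ n" using cU by (simp add: card_Pow)
  moreover have "2 ^ (n - 1) \<le> card M" unfolding M_def by (rule isoperimetry[OF S rS])
  ultimately show False using k_gt pow by linarith
qed

lemma b_chromatic_number_hypercube_power_le:
  assumes "p < n" "0 < r"
    and "\<And>S. S \<subseteq> Pow {1..n} \<Longrightarrow> r \<le> card S \<Longrightarrow>
      2 ^ (n - 1) \<le> card ((neighbourhood {1..n} ^^ (n - p - 1)) S)"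
  shows "int (b_chromatic_number (hypercube_power n p)) \<le> 2 ^ (n - 1) + \<lceil>real r / 2\<rceil> - 1"
  using b_chromatic_number_greatest(1)[OF pair_graph_hypercube_power, of n p]
    b_coloring_hypercube_power_le[OF _ assms] by blast

text \<open>Pascal's rule, summed. It identifies \<open>r'\<close> as twice the size of a ball in
  dimension \<open>n - 1\<close>.\<close>

lemma sum_choose_add_choose:
  "(\<Sum>i\<le>t. Suc n choose i) + (n choose t) = 2 * (\<Sum>i\<le>t. n choose i)"
  by (induction t) simp_all

theorem theorem4p2:
  shows "(\<forall>n p :: nat. odd n \<and> 5 \<le> n \<and> (n + 1) div 2 \<le> p \<and> p \<le> n - 2 \<longrightarrow>
            (let r = (\<Sum>i = 0..p - (n - 1) div 2. n choose i)
             in int (b_chromatic_number (hypercube_power n p)) \<le> 2 ^ (n - 1) + \<lceil>real r / 2\<rceil> - 1)) \<and>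
         (\<forall>n p :: nat. even n \<and> 6 \<le> n \<and> n div 2 + 1 \<le> p \<and> p \<le> n - 2 \<longrightarrow>
            (let r' = (\<Sum>i = 0..p - n div 2. n choose i) + ((n - 1) choose (p - n div 2))
             in int (b_chromatic_number (hypercube_power n p)) \<le> 2 ^ (n - 1) + \<lceil>real r' / 2\<rceil> - 1))"
proof (intro conjI allI impI)
  fix n p :: nat
  assume asm: "odd n \<and> 5 \<le> n \<and> (n + 1) div 2 \<le> p \<and> p \<le> n - 2"
  then obtain h where n: "n = 2 * h + 1" by (elim conjE oddE)
  \<comment> \<open>The radius of the ball of size \<open>r\<close>; after \<open>n - p - 1\<close>
    further steps the radius is \<open>h\<close>.\<close>
  define t where "t = p - h"
  have p: "h < p" "p < n" "t + (n - p - 1) = h" using asm n by (auto simp: t_def)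
  let ?F = "\<lambda>t. {x \<in> Pow {1..n}. card x \<le> t}"
  \<comment> \<open>The ground set starts at 1, so the ranks are taken with
    \<open>N = Suc n\<close>.\<close>
  have sub: "{1..n} \<subseteq> {..<Suc n}" by auto
  have "2 ^ (n - 1) \<le> card ((neighbourhood {1..n} ^^ (n - p - 1)) S)"
    if "S \<subseteq> Pow {1..n}" "(\<Sum>i\<le>t. n choose i) \<le> card S" for S
  proof -
    have "card (?F (t + (n - p - 1))) \<le> card ((neighbourhood {1..n} ^^ (n - p - 1)) S)"
    proof (rule card_iterated_neighbourhood_ge[OF sub that(1) initial_segment_ball[OF sub]])
      show "?F (Suc t) \<subseteq> neighbourhood {1..n} (?F t)" for t
        using neighbourhood_ball[of "{1..n}" "{}" t] by simp
      show "card (?F t) \<le> card S" using that(2) card_ball[of "{1..n}" t] by simp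
    qed
    \<comment> \<open>In dimension \<open>2 * h + 1\<close> the symmetry of the binomial
      coefficients makes the ball of radius \<open>h\<close> exactly half of the cube.\<close>
    moreover have "card (?F h) = 2 ^ (n - 1)"
      using binomial_r_part_sum[of h] card_ball[of "{1..n}" h] by (simp add: n)
    ultimately show ?thesis unfolding p(3) by simp
  qed
  moreover have "0 < (\<Sum>i\<le>t. n choose i)" by (rule sum_pos2[of _ 0]) auto
  ultimately show "let r = (\<Sum>i = 0..p - (n - 1) div 2. n choose i)
      in int (b_chromatic_number (hypercube_power n p)) \<le> 2 ^ (n - 1) + \<lceil>real r / 2\<rceil> - 1"
    using b_chromatic_number_hypercube_power_le[OF p(2), of "\<Sum>i\<le>t. n choose i"]
    by (simp add: Let_def n t_def atLeast0AtMost)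
next
  fix n p :: nat
  assume asm: "even n \<and> 6 \<le> n \<and> n div 2 + 1 \<le> p \<and> p \<le> n - 2"
  \<comment> \<open>Chosen so that \<open>n - 1 = 2 * h + 1\<close>: with coordinate
    \<open>n\<close> ignored, the half-cube count of odd dimension applies again.\<close>
  define h where "h = n div 2 - 1"
  have n: "n = 2 * h + 2" using asm by (auto simp: h_def)
  define t where "t = p - (h + 1)"
  have p: "p < n" "t + (n - p - 1) = h" using asm n by (auto simp: t_def)
  let ?F = "\<lambda>t. {x \<in> Pow {1..n}. card (x - {n}) \<le> t}"
  let ?r = "2 * (\<Sum>i\<le>t. (n - 1) choose i)"
  have sub: "{1..n} \<subseteq> {..<Suc n}" by auto
  have nA: "n \<in> {1..n}" using n by simp
  have "2 ^ (n - 1) \<le> card ((neighbourhood {1..n} ^^ (n - p - 1)) S)"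
    if "S \<subseteq> Pow {1..n}" "?r \<le> card S" for S
  proof -
    have "card (?F (t + (n - p - 1))) \<le> card ((neighbourhood {1..n} ^^ (n - p - 1)) S)"
    proof (rule card_iterated_neighbourhood_ge[OF sub that(1)])
      show "initial_segment (Suc n) {1..n} (?F t)" for t
        by (rule initial_segment_ball_Diff_Max[OF sub nA]) simp
      show "?F (Suc t) \<subseteq> neighbourhood {1..n} (?F t)" for t by (rule neighbourhood_ball) simp
      show "card (?F t) \<le> card S" using that(2) card_ball_Diff[OF _ nA, of t] by simp
    qed
    moreover have "card (?F h) = 2 ^ (n - 1)"
      using binomial_r_part_sum[of h] card_ball_Diff[OF _ nA, of h] by (simp add: n)
    ultimately show ?thesis unfolding p(2) by simp
  qed
  moreover have "0 < ?r" using sum_pos2[of "{..t}" 0 "\<lambda>i. (n - 1) choose i"] by simp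
  ultimately have bound: "int (b_chromatic_number (hypercube_power n p)) \<le>
      2 ^ (n - 1) + \<lceil>real ?r / 2\<rceil> - 1"
    by (intro b_chromatic_number_hypercube_power_le[OF p(1)])
  have r': "(\<Sum>i = 0..p - n div 2. n choose i) + ((n - 1) choose (p - n div 2)) = ?r"
    using sum_choose_add_choose[where n = "n - 1" and t = t] by (simp add: n t_def atLeast0AtMost)
  show "let r' = (\<Sum>i = 0..p - n div 2. n choose i) + ((n - 1) choose (p - n div 2))
      in int (b_chromatic_number (hypercube_power n p)) \<le> 2 ^ (n - 1) + \<lceil>real r' / 2\<rceil> - 1"
    unfolding Let_def r' by (rule bound)
qed

end
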